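(* Let $-1<\alpha<1$ and $-1<\beta<1$, and for $t\in\mathbb{R}$, $n\in\mathbb{Z}$ let $$p_n=\frac{(n+t+\beta+1)(n+t+\alpha+\beta+1)}{(2n+2t+\alpha+\beta+1)(2n+2t+\alpha+\beta+2)},\qquad q_n=\frac{(n+t)(n+t+\alpha)}{(2n+2t+\alpha+\beta)(2n+2t+\alpha+\beta+1)},$$ $$r_n=\frac{(n+t+\beta+1)(n+t+1)}{(2n+2t+\alpha+\beta+1)(2n+2t+\alpha+\beta+2)}+\frac{(n+t+\alpha)(n+t+\alpha+\beta)}{(2n+2t+\alpha+\beta)(2n+2t+\alpha+\beta+1)}.$$ (I) If $0\le\beta<1$, then there is no $t\in\mathbb{R}$ such that $p_n,r_n,q_n>0$ for all $n\in\mathbb{Z}$. (II) Assume $-1<\alpha<1$ and $-1<\beta<0$. Then $p_n,r_n,q_n>0$ for all $n\in\mathbb{Z}$ whenever $(\alpha,\beta)$ lies in one of the following eight regions and $t$ lies in the corresponding set: - $A_1$: $\beta-\alpha+1>0$, $\alpha>-\beta$, $\beta<0$, and $t\in\bigcup_{n\in\mathbb{Z}}(n,n-\beta)\cup(n-\alpha,n-\alpha-\beta)$; - $A_2$: $\beta-\alpha+1>0$, $\alpha<-\beta$, $\alpha>0$, and $t\in\bigcup_{n\in\mathbb{Z}}(n-\alpha,n)\cup(n-\alpha-\beta,n-\beta)$; - $B_1$: $\beta-\alpha+1<0$, $\alpha>-\beta$, $\alpha<1$, and $t\in\bigcup_{n\in\mathbb{Z}}(n,n-\alpha+1)\cup(n-\beta,n-\alpha-\beta+1)$;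 - $B_2$: $\beta-\alpha+1<0$, $\alpha<-\beta$, $\beta>-1$, and $t\in\bigcup_{n\in\mathbb{Z}}(n-\beta-1,n)\cup(n-\alpha-\beta,n-\alpha+1)$; - $C_1$: $\beta+\alpha+1>0$, $\alpha>\beta$, $\alpha<0$, and $t\in\bigcup_{n\in\mathbb{Z}}(n,n-\alpha)\cup(n-\beta,n-\alpha-\beta)$; - $C_2$: $\beta+\alpha+1>0$, $\alpha<\beta$, $\beta<0$, and $t\in\bigcup_{n\in\mathbb{Z}}(n,n-\beta)\cup(n-\alpha,n-\alpha-\beta)$; - $D_1$: $\beta+\alpha+1<0$, $\alpha>\beta$, $\beta>-1$, and $t\in\bigcup_{n\in\mathbb{Z}}(n-\beta-1,n)\cup(n-\alpha-\beta,n-\alpha+1)$; - $D_2$: $\beta+\alpha+1<0$, $\alpha<\beta$, $\alpha>-1$, and $t\in\bigcup_{n\in\mathbb{Z}}(n-\alpha-1,n)\cup(n-\alpha-\beta,n-\beta+1)$.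
   Context: $\alpha,\beta,t$ are real. The notation $(a,b)$ denotes an open real interval, and each union over $n\in\mathbb{Z}$ is the union of both displayed intervals over all integers $n$. The positivity of $p_n,r_n,q_n$ for all $n$ is understood to include that the coefficients are well defined, i.e. that no denominator vanishes. *)

theory Defs
  imports Complex_Main
begin

definition coeff_p :: "real \<Rightarrow> real \<Rightarrow> real \<Rightarrow> int \<Rightarrow> real" where
  "coeff_p \<alpha> \<beta> t n =
     ((n + t + \<beta> + 1) * (n + t + \<alpha> + \<beta> + 1)) /
     ((2*n + 2*t + \<alpha> + \<beta> + 1) * (2*n + 2*t + \<alpha> + \<beta> + 2))"

definition coeff_q :: "real \<Rightarrow> real \<Rightarrow> real \<Rightarrow> int \<Rightarrow> real" where
  "coeff_q \<alpha> \<beta> t n =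
     ((n + t) * (n + t + \<alpha>)) /
     ((2*n + 2*t + \<alpha> + \<beta>) * (2*n + 2*t + \<alpha> + \<beta> + 1))"

definition coeff_r :: "real \<Rightarrow> real \<Rightarrow> real \<Rightarrow> int \<Rightarrow> real" where
  "coeff_r \<alpha> \<beta> t n =
     ((n + t + \<beta> + 1) * (n + t + 1)) /
     ((2*n + 2*t + \<alpha> + \<beta> + 1) * (2*n + 2*t + \<alpha> + \<beta> + 2))
   + ((n + t + \<alpha>) * (n + t + \<alpha> + \<beta>)) /
     ((2*n + 2*t + \<alpha> + \<beta>) * (2*n + 2*t + \<alpha> + \<beta> + 1))"

text \<open>
  The factors below are all the factors of the denominators of the three coefficients.
  Their non-vanishing is required explicitly, because division is total in HOL.
\<close>

definition coeffs_well_defined :: "real \<Rightarrow> real \<Rightarrow> real \<Rightarrow> int \<Rightarrow> bool" where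
  "coeffs_well_defined \<alpha> \<beta> t n \<longleftrightarrow>
     2*n + 2*t + \<alpha> + \<beta> \<noteq> 0 \<and>
     2*n + 2*t + \<alpha> + \<beta> + 1 \<noteq> 0 \<and>
     2*n + 2*t + \<alpha> + \<beta> + 2 \<noteq> 0"

definition coeffs_positive :: "real \<Rightarrow> real \<Rightarrow> real \<Rightarrow> bool" where
  "coeffs_positive \<alpha> \<beta> t \<longleftrightarrow>
     (\<forall>n::int. coeffs_well_defined \<alpha> \<beta> t n \<and>
        coeff_p \<alpha> \<beta> t n > 0 \<and> coeff_r \<alpha> \<beta> t n > 0 \<and> coeff_q \<alpha> \<beta> t n > 0)"

end

theory Submission
  imports Defs
begin

text \<open>
  Put \<open>a = \<alpha> - \<beta>\<close>, \<open>b = -(\<alpha> + \<beta>)\<close> and \<open>w = 2 * (n + t) + \<alpha> + \<beta>\<close>. In these coordinates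
  the coefficients are
  \<open>p = (w' - a) * (w' - b) / (4 * w' * (w' - 1))\<close> with \<open>w' = w + 2\<close>,
  \<open>q = (w + a) * (w + b) / (4 * w * (w + 1))\<close> and
  \<open>r = (w * (w + 2) - a * b) / (2 * w * (w + 2))\<close>.
  Since \<open>w\<close> runs through a coset of \<open>2\<int>\<close>, the shift in \<open>p\<close> is harmless, and the problem becomes
  symmetric in \<open>a\<close> and \<open>b\<close>, while \<open>w \<mapsto> -w\<close> exchanges the conditions from \<open>p\<close> and \<open>q\<close>.

  Everything depends on the representative \<open>v\<close> of the coset that is smallest in absolute value;
  \<open>0 < \<bar>v\<bar> < 1\<close> since all denominators are nonzero. For \<open>v > 0\<close>, positivity of \<open>p\<close> forces \<open>v\<close>
  to separate \<open>a\<close> from \<open>b\<close>, and positivity of \<open>q\<close> forces \<open>-v\<close> not to separate them; so the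
  smaller of \<open>a\<close>, \<open>b\<close> lies above \<open>-v\<close>, the larger one above \<open>v\<close>, and \<open>-2 * \<beta> = a + b > 0\<close>
  (\<open>positive_at_imp_sum_pos\<close>). The case \<open>v < 0\<close> is the mirror image. This is part (I).

  Conversely, let \<open>M\<close> be the larger of \<open>a\<close>, \<open>b\<close> and \<open>m\<close> the other one. If
  \<open>\<bar>m\<bar> < \<bar>v\<bar> < M < 2 - \<bar>v\<bar>\<close>, then all conditions hold on the whole coset
  (\<open>positive_at_coset\<close>): \<open>v\<close> realises the sign pattern just described, and the other
  elements have absolute value at least \<open>2 - \<bar>v\<bar>\<close>, so they are too large for \<open>a\<close> and \<open>b\<close> to
  affect any sign.

  The eight regions of part (II) list the possible configurations: \<open>M\<close> is \<open>a\<close> in the \<open>A\<close> and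
  \<open>B\<close> regions and \<open>b\<close> in the \<open>C\<close> and \<open>D\<close> regions; \<open>M\<close> is less than 1 in \<open>A\<close> and \<open>C\<close>
  and greater than 1 in \<open>B\<close> and \<open>D\<close>; the subscripts 1 and 2 distinguish the two signs of \<open>m\<close>. In each region the
  two families of intervals are the cases \<open>v > 0\<close> and \<open>v < 0\<close> of
  \<open>\<bar>m\<bar> < \<bar>v\<bar> < min M (2 - M)\<close>.
\<close>

section \<open>The conditions in centred coordinates\<close>

text \<open>
  A quotient and the product of its numerator and denominator have the same sign, and both vanish
  if the denominator does. Hence strict positivity of these products also records that no
  denominator vanishes.
\<close>

definition positive_at :: "real \<Rightarrow> real \<Rightarrow> real \<Rightarrow> bool" where
  "positive_at a b w \<longleftrightarrow>
     0 < (w - a) * (w - b) * (w * (w - 1)) \<and>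
     0 < (w + a) * (w + b) * (w * (w + 1)) \<and>
     0 < (w * (w + 2) - a * b) * (w * (w + 2))"

lemma positive_at_commute: "positive_at a b w \<longleftrightarrow> positive_at b a w"
  unfolding positive_at_def by (simp add: mult.commute)

lemma divide_pos_iff_mult_pos:
  fixes x y c :: real
  assumes "0 < c"
  shows "0 < x / y / c \<longleftrightarrow> 0 < x * y"
proof -
  have "0 < x / y / c \<longleftrightarrow> 0 < x / y" using assms zero_less_divide_iff[of "x / y" c] by linarith
  then show ?thesis by (simp only: zero_less_divide_iff zero_less_mult_iff)
qed

lemma coeff_p_centred:
  fixes n :: int and \<alpha> \<beta> t :: real
  defines "w \<equiv> 2 * real_of_int (n + 1) + 2 * t + \<alpha> + \<beta>"
  shows "coeff_p \<alpha> \<beta> t n = (w - (\<alpha> - \<beta>)) * (w - -(\<alpha> + \<beta>)) / (w * (w - 1)) / 4"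
proof -
  have factors: "n + t + \<beta> + 1 = (w - (\<alpha> - \<beta>)) / 2" "n + t + \<alpha> + \<beta> + 1 = (w - -(\<alpha> + \<beta>)) / 2"
    by (simp_all add: w_def field_simps)
  have denominators: "2 * real_of_int n + 2 * t + \<alpha> + \<beta> + 1 = w - 1"
    "2 * real_of_int n + 2 * t + \<alpha> + \<beta> + 2 = w"
    by (simp_all add: w_def field_simps)
  show ?thesis
    unfolding coeff_p_def factors denominators by (simp add: mult.commute)
qed

lemma coeff_q_centred:
  fixes n :: int and \<alpha> \<beta> t :: real
  defines "w \<equiv> 2 * real_of_int n + 2 * t + \<alpha> + \<beta>"
  shows "coeff_q \<alpha> \<beta> t n = (w + (\<alpha> - \<beta>)) * (w + -(\<alpha> + \<beta>)) / (w * (w + 1)) / 4"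
proof -
  have denominators: "2 * real_of_int n + 2 * t + \<alpha> + \<beta> = w"
    "2 * real_of_int n + 2 * t + \<alpha> + \<beta> + 1 = w + 1"
    by (simp_all add: w_def)
  have factors: "n + t = (w + -(\<alpha> + \<beta>)) / 2" "n + t + \<alpha> = (w + (\<alpha> - \<beta>)) / 2"
    by (simp_all add: w_def field_simps)
  show ?thesis
    unfolding coeff_q_def denominators(2) unfolding denominators(1) factors(2)
    unfolding factors(1) by (simp add: mult.commute)
qed

text \<open>
  The two summands of \<open>r\<close> share the denominator factor \<open>w + 1\<close>, and their residues at \<open>w = -1\<close>
  cancel. Without that factor the sign of \<open>r\<close> depends on \<open>w * (w + 2)\<close> alone.
\<close>

lemma coeff_r_centred:
  fixes n :: int and \<alpha> \<beta> t :: real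
  defines "w \<equiv> 2 * real_of_int n + 2 * t + \<alpha> + \<beta>"
  assumes "w \<noteq> 0" "w + 1 \<noteq> 0" "w + 2 \<noteq> 0"
  shows "coeff_r \<alpha> \<beta> t n = (w * (w + 2) - (\<alpha> - \<beta>) * -(\<alpha> + \<beta>)) / (w * (w + 2)) / 2"
proof -
  have denominators: "2 * real_of_int n + 2 * t + \<alpha> + \<beta> = w"
    "2 * real_of_int n + 2 * t + \<alpha> + \<beta> + 1 = w + 1"
    "2 * real_of_int n + 2 * t + \<alpha> + \<beta> + 2 = w + 2"
    by (simp_all add: w_def)
  have factors: "n + t + \<beta> + 1 = (w + 2 - (\<alpha> - \<beta>)) / 2" "n + t + 1 = (w + 2 - (\<alpha> + \<beta>)) / 2"
    "n + t + \<alpha> = (w + (\<alpha> - \<beta>)) / 2" "n + t + \<alpha> + \<beta> = (w + (\<alpha> + \<beta>)) / 2"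
    by (simp_all add: w_def field_simps)
  have "coeff_r \<alpha> \<beta> t n =
      (w + 2 - (\<alpha> - \<beta>)) * (w + 2 - (\<alpha> + \<beta>)) / (4 * ((w + 1) * (w + 2)))
      + (w + (\<alpha> - \<beta>)) * (w + (\<alpha> + \<beta>)) / (4 * (w * (w + 1)))"
    unfolding coeff_r_def denominators(2,3) unfolding denominators(1) factors(1,2,4)
    unfolding factors(3) by simp
  also have "\<dots> = ((w + 2 - (\<alpha> - \<beta>)) * (w + 2 - (\<alpha> + \<beta>)) * w
      + (w + (\<alpha> - \<beta>)) * (w + (\<alpha> + \<beta>)) * (w + 2)) / (4 * (w * (w + 1) * (w + 2)))"
    using assms(2-4) by (simp add: add_frac_eq frac_eq_eq) algebra
  also have "\<dots> = (w * (w + 2) - (\<alpha> - \<beta>) * -(\<alpha> + \<beta>)) * (2 * (w + 1)) / (w * (w + 2) * 2 * (2 * (w + 1)))"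
    by (rule arg_cong2[where f = "(/)"]) algebra+
  also have "\<dots> = (w * (w + 2) - (\<alpha> - \<beta>) * -(\<alpha> + \<beta>)) / (w * (w + 2)) / 2"
    using assms(3) by simp
  finally show ?thesis .
qed

lemma coeffs_positive_iff_positive_at:
  "coeffs_positive \<alpha> \<beta> t \<longleftrightarrow>
     (\<forall>n::int. positive_at (\<alpha> - \<beta>) (-(\<alpha> + \<beta>)) (2 * real_of_int n + 2 * t + \<alpha> + \<beta>))"
proof -
  define a b where "a = \<alpha> - \<beta>" and "b = -(\<alpha> + \<beta>)"
  define w where "w n = 2 * real_of_int n + 2 * t + \<alpha> + \<beta>" for n :: int
  have p: "0 < coeff_p \<alpha> \<beta> t n \<longleftrightarrow>
      0 < (w (n + 1) - a) * (w (n + 1) - b) * (w (n + 1) * (w (n + 1) - 1))" for n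
    unfolding coeff_p_centred a_def b_def w_def by (rule divide_pos_iff_mult_pos) simp
  have q: "0 < coeff_q \<alpha> \<beta> t n \<longleftrightarrow> 0 < (w n + a) * (w n + b) * (w n * (w n + 1))" for n
    unfolding coeff_q_centred a_def b_def w_def by (rule divide_pos_iff_mult_pos) simp
  have r: "0 < coeff_r \<alpha> \<beta> t n \<longleftrightarrow> 0 < (w n * (w n + 2) - a * b) * (w n * (w n + 2))"
    if "w n \<noteq> 0" "w n + 1 \<noteq> 0" "w n + 2 \<noteq> 0" for n
    unfolding coeff_r_centred[OF that[unfolded w_def]] a_def b_def w_def
    by (rule divide_pos_iff_mult_pos) simp
  have well_defined:
    "coeffs_well_defined \<alpha> \<beta> t n \<longleftrightarrow> w n \<noteq> 0 \<and> w n + 1 \<noteq> 0 \<and> w n + 2 \<noteq> 0" for n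
    unfolding coeffs_well_defined_def w_def by simp
  show ?thesis
    unfolding a_def[symmetric] b_def[symmetric] w_def[symmetric]
  proof
    assume pos: "coeffs_positive \<alpha> \<beta> t"
    show "\<forall>n. positive_at a b (w n)"
    proof
      fix n
      have "0 < (w n - a) * (w n - b) * (w n * (w n - 1))"
        using pos p[of "n - 1"] unfolding coeffs_positive_def by simp
      moreover have "0 < (w n + a) * (w n + b) * (w n * (w n + 1))"
        using pos q unfolding coeffs_positive_def by blast
      moreover have "0 < (w n * (w n + 2) - a * b) * (w n * (w n + 2))"
        using pos r well_defined unfolding coeffs_positive_def by blast
      ultimately show "positive_at a b (w n)"
        unfolding positive_at_def by blast
    qed
  next
    assume pos: "\<forall>n. positive_at a b (w n)"
    have wd: "coeffs_well_defined \<alpha> \<beta> t n" for n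
    proof -
      have "positive_at a b (w n)" using pos by blast
      then show ?thesis
        unfolding well_defined positive_at_def by auto
    qed
    have "0 < coeff_p \<alpha> \<beta> t n \<and> 0 < coeff_r \<alpha> \<beta> t n \<and> 0 < coeff_q \<alpha> \<beta> t n" for n
      using pos p q r wd well_defined unfolding positive_at_def by blast
    then show "coeffs_positive \<alpha> \<beta> t"
      unfolding coeffs_positive_def using wd by blast
  qed
qed

section \<open>Necessity: the smallest representative determines the sign of the sum\<close>

text \<open>
  On \<open>0 < \<bar>v\<bar> < 1\<close> the denominators \<open>v * (v - 1)\<close> and \<open>v * (v + 1)\<close> have opposite signs. Hence
  exactly one of \<open>v\<close>, \<open>-v\<close>, namely \<open>\<bar>v\<bar>\<close>, separates \<open>a\<close> from \<open>b\<close>; if the sum were not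
  positive, the parameter below \<open>\<bar>v\<bar>\<close> would also be below \<open>-\<bar>v\<bar>\<close>, and both would separate.
\<close>

lemma positive_at_imp_sum_pos:
  assumes pos: "positive_at a b v" and "\<bar>v\<bar> < 1"
  shows "0 < a + b"
proof -
  define X where "X = (v - a) * (v - b)"
  define Y where "Y = (v + a) * (v + b)"
  have X: "0 < X * (v * (v - 1))" and Y: "0 < Y * (v * (v + 1))"
    using pos by (simp_all add: positive_at_def X_def Y_def)
  have "(\<bar>v\<bar> - a) * (\<bar>v\<bar> - b) < 0 \<and> 0 < (\<bar>v\<bar> + a) * (\<bar>v\<bar> + b)"
  proof (cases "0 < v")
    case True
    then have "v * (v - 1) < 0" "0 < v * (v + 1)"
      using \<open>\<bar>v\<bar> < 1\<close> by (auto intro: mult_pos_neg)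
    then have "X < 0" "0 < Y"
      using X Y zero_less_mult_iff[of X] zero_less_mult_iff[of Y] by (metis order_less_asym)+
    with True show ?thesis by (simp add: X_def Y_def)
  next
    case False
    moreover have "v \<noteq> 0" using X by auto
    ultimately have "v < 0" by simp
    then have "0 < v * (v - 1)" "v * (v + 1) < 0"
      using \<open>\<bar>v\<bar> < 1\<close> by (auto intro: mult_neg_neg mult_neg_pos)
    then have "0 < X" "Y < 0"
      using X Y zero_less_mult_iff[of X] zero_less_mult_iff[of Y] by (metis order_less_asym)+
    moreover have "(- v - a) * (- v - b) = Y" "(- v + a) * (- v + b) = X"
      unfolding X_def Y_def by algebra+
    ultimately show ?thesis using \<open>v < 0\<close> by simp
  qed
  then have separates: "(\<bar>v\<bar> - a) * (\<bar>v\<bar> - b) < 0" and not_separates: "0 < (\<bar>v\<bar> + a) * (\<bar>v\<bar> + b)"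
    by blast+
  consider "\<bar>v\<bar> < a" "b < \<bar>v\<bar>" | "\<bar>v\<bar> < b" "a < \<bar>v\<bar>"
    using separates by (auto simp: mult_less_0_iff)
  then show ?thesis
    using not_separates by cases (auto simp: zero_less_mult_iff)
qed

lemma coeffs_positive_imp_beta_neg:
  assumes pos: "coeffs_positive \<alpha> \<beta> t"
  shows "\<beta> < 0"
proof -
  define k where "k = \<lfloor>(1 - (2 * t + \<alpha> + \<beta>)) / 2\<rfloor>"
  define v where "v = 2 * real_of_int k + 2 * t + \<alpha> + \<beta>"
  have "-1 < v" "v \<le> 1"
    using floor_correct[of "(1 - (2 * t + \<alpha> + \<beta>)) / 2"]
    unfolding v_def k_def by (simp_all add: field_simps)
  have at_v: "positive_at (\<alpha> - \<beta>) (-(\<alpha> + \<beta>)) v"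
    using pos unfolding coeffs_positive_iff_positive_at v_def by blast
  then have "v \<noteq> 1" by (auto simp: positive_at_def)
  with \<open>-1 < v\<close> \<open>v \<le> 1\<close> have "\<bar>v\<bar> < 1" by linarith
  from positive_at_imp_sum_pos[OF at_v this] show ?thesis by simp
qed

section \<open>Sufficiency: one inequality controls the whole coset\<close>

text \<open>
  In this range \<open>w\<close> exceeds \<open>a\<close>, \<open>b\<close> and \<open>1\<close> in absolute value, so every linear factor
  has the sign of \<open>w\<close>. The condition on \<open>r\<close> needs separate treatment, because \<open>w + 2\<close> may
  have small absolute value even if \<open>w\<close> does not.
\<close>

lemma positive_at_far:
  fixes a b w :: real
  assumes "\<bar>b\<bar> < \<bar>w\<bar>" "\<bar>a\<bar> < \<bar>w\<bar>" "1 < \<bar>w\<bar>"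
  shows "0 < (w - a) * (w - b) * (w * (w - 1))" "0 < (w + a) * (w + b) * (w * (w + 1))"
proof -
  have "0 < (w - a) * (w - b) * (w * (w - 1)) \<and> 0 < (w + a) * (w + b) * (w * (w + 1))"
  proof (cases "0 < w")
    case True
    then have "0 < w - a" "0 < w - b" "0 < w - 1" "0 < w + a" "0 < w + b" "0 < w + 1"
      using assms by linarith+
    with True show ?thesis by simp
  next
    case False
    then have "w < 0" "w - a < 0" "w - b < 0" "w - 1 < 0" "w + a < 0" "w + b < 0" "w + 1 < 0"
      using assms by linarith+
    then have "0 < (w - a) * (w - b)" "0 < w * (w - 1)"
      "0 < (w + a) * (w + b)" "0 < w * (w + 1)"
      by (auto intro: mult_neg_neg)
    then show ?thesis by simp
  qed
  then show "0 < (w - a) * (w - b) * (w * (w - 1))" "0 < (w + a) * (w + b) * (w * (w + 1))"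
    by blast+
qed

text \<open>
  Among the elements of the coset, only \<open>v\<close> itself is smaller than \<open>a\<close> in absolute value, so it alone
  needs a sign check in the first two conditions. In the third condition it occurs in \<open>w * (w + 2)\<close>
  for \<open>w = v\<close> and \<open>w = v - 2\<close>, and there \<open>\<bar>w * (w + 2)\<bar> \<ge> \<bar>v\<bar> * (2 - \<bar>v\<bar>) > \<bar>b\<bar> * a\<close>. For all other
  \<open>w\<close> both factors exceed \<open>a\<close> in absolute value. So adding \<open>- a * b\<close> never changes the sign.
\<close>

lemma positive_at_coset:
  fixes k :: int
  assumes "\<bar>b\<bar> < \<bar>v\<bar>" "\<bar>v\<bar> < a" "a < 2 - \<bar>v\<bar>"
  shows "positive_at a b (v + 2 * real_of_int k)"
proof -
  define w where "w = v + 2 * real_of_int k"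
  have far: "2 - \<bar>v\<bar> \<le> \<bar>v + 2 * real_of_int j\<bar>" if "j \<noteq> 0" for j :: int
  proof -
    have "1 \<le> \<bar>real_of_int j\<bar>" using that by linarith
    then show ?thesis by linarith
  qed
  have pq: "0 < (w - a) * (w - b) * (w * (w - 1)) \<and> 0 < (w + a) * (w + b) * (w * (w + 1))"
  proof (cases "k = 0")
    case True
    then have "w = v" by (simp add: w_def)
    show ?thesis
      unfolding \<open>w = v\<close>
    proof (cases "0 < v")
      case True
      then have "v - a < 0" "0 < v - b" "v - 1 < 0" "0 < v + a" "0 < v + b" "0 < v + 1"
        using assms by linarith+
      with True show "0 < (v - a) * (v - b) * (v * (v - 1)) \<and> 0 < (v + a) * (v + b) * (v * (v + 1))"
        by (simp add: zero_less_mult_iff mult_less_0_iff)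
    next
      case False
      then have "v < 0" "v - a < 0" "v - b < 0" "v - 1 < 0" "0 < v + a" "v + b < 0" "0 < v + 1"
        using assms by linarith+
      then show "0 < (v - a) * (v - b) * (v * (v - 1)) \<and> 0 < (v + a) * (v + b) * (v * (v + 1))"
        by (simp add: zero_less_mult_iff mult_less_0_iff)
    qed
  next
    case False
    then have "2 - \<bar>v\<bar> \<le> \<bar>w\<bar>" using far by (simp add: w_def)
    with assms have "\<bar>b\<bar> < \<bar>w\<bar>" "\<bar>a\<bar> < \<bar>w\<bar>" "1 < \<bar>w\<bar>" by linarith+
    then show ?thesis using positive_at_far by blast
  qed
  have r_bound: "\<bar>a * b\<bar> < \<bar>w * (w + 2)\<bar>"
  proof -
    \<comment> \<open>At most one of \<open>w\<close>, \<open>w + 2\<close> is \<open>v\<close>; every other element of the coset exceeds \<open>a\<close> in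
      absolute value.\<close>
    have "(a < \<bar>w\<bar> \<and> \<bar>b\<bar> < \<bar>w + 2\<bar>) \<or> (\<bar>b\<bar> < \<bar>w\<bar> \<and> a < \<bar>w + 2\<bar>)"
    proof (cases "k = 0")
      case True
      then show ?thesis using far[of 1] assms by (simp add: w_def)
    next
      case False
      then have "a < \<bar>w\<bar>" using far assms by (fastforce simp: w_def)
      moreover have "\<bar>b\<bar> < \<bar>w + 2\<bar>"
        using far[of "k + 1"] assms
        by (cases "k + 1 = 0") (auto simp: w_def algebra_simps eq_neg_iff_add_eq_0)
      ultimately show ?thesis by blast
    qed
    moreover have "0 < a" using assms by linarith
    ultimately have "a * \<bar>b\<bar> < \<bar>w\<bar> * \<bar>w + 2\<bar>"
      using mult_strict_mono'[of a "\<bar>w\<bar>" "\<bar>b\<bar>" "\<bar>w + 2\<bar>"]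
        mult_strict_mono'[of "\<bar>b\<bar>" "\<bar>w\<bar>" a "\<bar>w + 2\<bar>"] by (auto simp: mult.commute)
    then show ?thesis using \<open>0 < a\<close> by (simp add: abs_mult)
  qed
  have "0 < (w * (w + 2) - a * b) * (w * (w + 2))"
  proof (cases "0 < w * (w + 2)")
    case True
    with r_bound have "0 < w * (w + 2) - a * b" by linarith
    with True show ?thesis by (rule mult_pos_pos[rotated])
  next
    case False
    with r_bound have "w * (w + 2) - a * b < 0" "w * (w + 2) < 0" by linarith+
    then show ?thesis by (rule mult_neg_neg)
  qed
  with pq show ?thesis unfolding positive_at_def w_def by blast
qed

text \<open>
  The disjunction says which of \<open>\<alpha> - \<beta>\<close> and \<open>-(\<alpha> + \<beta>)\<close> is the dominant parameter. The
  hypothesis forces \<open>\<bar>v\<bar> < 1\<close>, so \<open>m\<close> must select the smallest representative of the coset.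
\<close>

lemma coeffs_positive_if_central:
  fixes m :: int and \<alpha> \<beta> t :: real
  defines "v \<equiv> 2 * (t - real_of_int m) + \<alpha> + \<beta>"
  assumes "\<bar>\<alpha> + \<beta>\<bar> < \<bar>v\<bar> \<and> \<bar>v\<bar> < \<alpha> - \<beta> \<and> \<alpha> - \<beta> < 2 - \<bar>v\<bar> \<or>
    \<bar>\<alpha> - \<beta>\<bar> < \<bar>v\<bar> \<and> \<bar>v\<bar> < -(\<alpha> + \<beta>) \<and> -(\<alpha> + \<beta>) < 2 - \<bar>v\<bar>"
  shows "coeffs_positive \<alpha> \<beta> t"
  unfolding coeffs_positive_iff_positive_at
proof
  fix n :: int
  have "2 * real_of_int n + 2 * t + \<alpha> + \<beta> = v + 2 * real_of_int (n + m)"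
    by (simp add: v_def algebra_simps)
  moreover have "positive_at (\<alpha> - \<beta>) (-(\<alpha> + \<beta>)) (v + 2 * real_of_int (n + m))"
    using assms(2)
  proof
    assume "\<bar>\<alpha> + \<beta>\<bar> < \<bar>v\<bar> \<and> \<bar>v\<bar> < \<alpha> - \<beta> \<and> \<alpha> - \<beta> < 2 - \<bar>v\<bar>"
    then show ?thesis by (intro positive_at_coset) auto
  next
    assume "\<bar>\<alpha> - \<beta>\<bar> < \<bar>v\<bar> \<and> \<bar>v\<bar> < -(\<alpha> + \<beta>) \<and> -(\<alpha> + \<beta>) < 2 - \<bar>v\<bar>"
    then show ?thesis
      by (subst positive_at_commute, intro positive_at_coset) auto
  qed
  ultimately show "positive_at (\<alpha> - \<beta>) (-(\<alpha> + \<beta>)) (2 * real_of_int n + 2 * t + \<alpha> + \<beta>)"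
    by (simp only:)
qed

section \<open>Translation of the eight regions\<close>

theorem proposition3p1:
  fixes \<alpha> \<beta> :: real
  assumes "-1 < \<alpha>" "\<alpha> < 1" "-1 < \<beta>" "\<beta> < 1"
  shows
    "(0 \<le> \<beta> \<longrightarrow> \<not> (\<exists>t::real. coeffs_positive \<alpha> \<beta> t)) \<and>
     (\<beta> < 0 \<longrightarrow> (\<forall>t::real.
        (\<beta> - \<alpha> + 1 > 0 \<and> \<alpha> > -\<beta> \<and> \<beta> < 0 \<and>
           t \<in> (\<Union>n::int. {n<..<n - \<beta>} \<union> {n - \<alpha><..<n - \<alpha> - \<beta>})
         \<longrightarrow> coeffs_positive \<alpha> \<beta> t) \<and>
        (\<beta> - \<alpha> + 1 > 0 \<and> \<alpha> < -\<beta> \<and> \<alpha> > 0 \<and>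
           t \<in> (\<Union>n::int. {n - \<alpha><..<n} \<union> {n - \<alpha> - \<beta><..<n - \<beta>})
         \<longrightarrow> coeffs_positive \<alpha> \<beta> t) \<and>
        (\<beta> - \<alpha> + 1 < 0 \<and> \<alpha> > -\<beta> \<and> \<alpha> < 1 \<and>
           t \<in> (\<Union>n::int. {n<..<n - \<alpha> + 1} \<union> {n - \<beta><..<n - \<alpha> - \<beta> + 1})
         \<longrightarrow> coeffs_positive \<alpha> \<beta> t) \<and>
        (\<beta> - \<alpha> + 1 < 0 \<and> \<alpha> < -\<beta> \<and> \<beta> > -1 \<and>
           t \<in> (\<Union>n::int. {n - \<beta> - 1<..<n} \<union> {n - \<alpha> - \<beta><..<n - \<alpha> + 1})
         \<longrightarrow> coeffs_positive \<alpha> \<beta> t) \<and>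
        (\<beta> + \<alpha> + 1 > 0 \<and> \<alpha> > \<beta> \<and> \<alpha> < 0 \<and>
           t \<in> (\<Union>n::int. {n<..<n - \<alpha>} \<union> {n - \<beta><..<n - \<alpha> - \<beta>})
         \<longrightarrow> coeffs_positive \<alpha> \<beta> t) \<and>
        (\<beta> + \<alpha> + 1 > 0 \<and> \<alpha> < \<beta> \<and> \<beta> < 0 \<and>
           t \<in> (\<Union>n::int. {n<..<n - \<beta>} \<union> {n - \<alpha><..<n - \<alpha> - \<beta>})
         \<longrightarrow> coeffs_positive \<alpha> \<beta> t) \<and>
        (\<beta> + \<alpha> + 1 < 0 \<and> \<alpha> > \<beta> \<and> \<beta> > -1 \<and>
           t \<in> (\<Union>n::int. {n - \<beta> - 1<..<n} \<union> {n - \<alpha> - \<beta><..<n - \<alpha> + 1})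
         \<longrightarrow> coeffs_positive \<alpha> \<beta> t) \<and>
        (\<beta> + \<alpha> + 1 < 0 \<and> \<alpha> < \<beta> \<and> \<alpha> > -1 \<and>
           t \<in> (\<Union>n::int. {n - \<alpha> - 1<..<n} \<union> {n - \<alpha> - \<beta><..<n - \<beta> + 1})
         \<longrightarrow> coeffs_positive \<alpha> \<beta> t)))"
proof -
  \<comment> \<open>For \<open>t\<close> in an interval indexed by \<open>n\<close>, the smallest representative belongs to the shift
    \<open>m = n\<close>, except where \<open>2 * (t - n) + \<alpha> + \<beta>\<close> lies outside \<open>[-1, 1]\<close>: it is below \<open>-1\<close> in the first
    interval of the regions \<open>D\<close>, where \<open>m = n - 1\<close>, and above \<open>1\<close> in the second interval of \<open>B\<^sub>1\<close>
    and of the regions \<open>D\<close>, where \<open>m = n + 1\<close>.\<close>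
  have A1: "coeffs_positive \<alpha> \<beta> t"
    if region: "\<beta> - \<alpha> + 1 > 0" "\<alpha> > -\<beta>" "\<beta> < 0"
      and t: "t \<in> (\<Union>n::int. {n<..<n - \<beta>} \<union> {n - \<alpha><..<n - \<alpha> - \<beta>})" for t
  proof -
    from t obtain n :: int where "t \<in> {n<..<n - \<beta>} \<or> t \<in> {n - \<alpha><..<n - \<alpha> - \<beta>}"
      by blast
    then show ?thesis
    proof
      assume "t \<in> {n<..<n - \<beta>}"
      then have "n < t" "t < n - \<beta>" by simp_all
      with region assms show ?thesis
        by (intro coeffs_positive_if_central[where m = "n"] disjI1 conjI)
          (simp_all add: abs_real_def)
    next
      assume "t \<in> {n - \<alpha><..<n - \<alpha> - \<beta>}"
      then have "n - \<alpha> < t" "t < n - \<alpha> - \<beta>" by simp_all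
      with region assms show ?thesis
        by (intro coeffs_positive_if_central[where m = "n"] disjI1 conjI)
          (simp_all add: abs_real_def)
    qed
  qed
  have A2: "coeffs_positive \<alpha> \<beta> t"
    if region: "\<beta> - \<alpha> + 1 > 0" "\<alpha> < -\<beta>" "\<alpha> > 0"
      and t: "t \<in> (\<Union>n::int. {n - \<alpha><..<n} \<union> {n - \<alpha> - \<beta><..<n - \<beta>})" for t
  proof -
    from t obtain n :: int where "t \<in> {n - \<alpha><..<n} \<or> t \<in> {n - \<alpha> - \<beta><..<n - \<beta>}"
      by blast
    then show ?thesis
    proof
      assume "t \<in> {n - \<alpha><..<n}"
      then have "n - \<alpha> < t" "t < n" by simp_all
      with region assms show ?thesis
        by (intro coeffs_positive_if_central[where m = "n"] disjI1 conjI)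
          (simp_all add: abs_real_def)
    next
      assume "t \<in> {n - \<alpha> - \<beta><..<n - \<beta>}"
      then have "n - \<alpha> - \<beta> < t" "t < n - \<beta>" by simp_all
      with region assms show ?thesis
        by (intro coeffs_positive_if_central[where m = "n"] disjI1 conjI)
          (simp_all add: abs_real_def)
    qed
  qed
  have B1: "coeffs_positive \<alpha> \<beta> t"
    if region: "\<beta> - \<alpha> + 1 < 0" "\<alpha> > -\<beta>" "\<alpha> < 1"
      and t: "t \<in> (\<Union>n::int. {n<..<n - \<alpha> + 1} \<union> {n - \<beta><..<n - \<alpha> - \<beta> + 1})" for t
  proof -
    from t obtain n :: int where "t \<in> {n<..<n - \<alpha> + 1} \<or> t \<in> {n - \<beta><..<n - \<alpha> - \<beta> + 1}"
      by blast
    then show ?thesis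
    proof
      assume "t \<in> {n<..<n - \<alpha> + 1}"
      then have "n < t" "t < n - \<alpha> + 1" by simp_all
      with region assms show ?thesis
        by (intro coeffs_positive_if_central[where m = "n"] disjI1 conjI)
          (simp_all add: abs_real_def)
    next
      assume "t \<in> {n - \<beta><..<n - \<alpha> - \<beta> + 1}"
      then have "n - \<beta> < t" "t < n - \<alpha> - \<beta> + 1" by simp_all
      with region assms show ?thesis
        by (intro coeffs_positive_if_central[where m = "n + 1"] disjI1 conjI)
          (simp_all add: abs_real_def)
    qed
  qed
  have B2: "coeffs_positive \<alpha> \<beta> t"
    if region: "\<beta> - \<alpha> + 1 < 0" "\<alpha> < -\<beta>" "\<beta> > -1"
      and t: "t \<in> (\<Union>n::int. {n - \<beta> - 1<..<n} \<union> {n - \<alpha> - \<beta><..<n - \<alpha> + 1})" for t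
  proof -
    from t obtain n :: int where "t \<in> {n - \<beta> - 1<..<n} \<or> t \<in> {n - \<alpha> - \<beta><..<n - \<alpha> + 1}"
      by blast
    then show ?thesis
    proof
      assume "t \<in> {n - \<beta> - 1<..<n}"
      then have "n - \<beta> - 1 < t" "t < n" by simp_all
      with region assms show ?thesis
        by (intro coeffs_positive_if_central[where m = "n"] disjI1 conjI)
          (simp_all add: abs_real_def)
    next
      assume "t \<in> {n - \<alpha> - \<beta><..<n - \<alpha> + 1}"
      then have "n - \<alpha> - \<beta> < t" "t < n - \<alpha> + 1" by simp_all
      with region assms show ?thesis
        by (intro coeffs_positive_if_central[where m = "n"] disjI1 conjI)
          (simp_all add: abs_real_def)
    qed
  qed
  have C1: "coeffs_positive \<alpha> \<beta> t"
    if region: "\<beta> + \<alpha> + 1 > 0" "\<alpha> > \<beta>" "\<alpha> < 0"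
      and t: "t \<in> (\<Union>n::int. {n<..<n - \<alpha>} \<union> {n - \<beta><..<n - \<alpha> - \<beta>})" for t
  proof -
    from t obtain n :: int where "t \<in> {n<..<n - \<alpha>} \<or> t \<in> {n - \<beta><..<n - \<alpha> - \<beta>}"
      by blast
    then show ?thesis
    proof
      assume "t \<in> {n<..<n - \<alpha>}"
      then have "n < t" "t < n - \<alpha>" by simp_all
      with region assms show ?thesis
        by (intro coeffs_positive_if_central[where m = "n"] disjI2 conjI)
          (simp_all add: abs_real_def)
    next
      assume "t \<in> {n - \<beta><..<n - \<alpha> - \<beta>}"
      then have "n - \<beta> < t" "t < n - \<alpha> - \<beta>" by simp_all
      with region assms show ?thesis
        by (intro coeffs_positive_if_central[where m = "n"] disjI2 conjI)
          (simp_all add: abs_real_def)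
    qed
  qed
  have C2: "coeffs_positive \<alpha> \<beta> t"
    if region: "\<beta> + \<alpha> + 1 > 0" "\<alpha> < \<beta>" "\<beta> < 0"
      and t: "t \<in> (\<Union>n::int. {n<..<n - \<beta>} \<union> {n - \<alpha><..<n - \<alpha> - \<beta>})" for t
  proof -
    from t obtain n :: int where "t \<in> {n<..<n - \<beta>} \<or> t \<in> {n - \<alpha><..<n - \<alpha> - \<beta>}"
      by blast
    then show ?thesis
    proof
      assume "t \<in> {n<..<n - \<beta>}"
      then have "n < t" "t < n - \<beta>" by simp_all
      with region assms show ?thesis
        by (intro coeffs_positive_if_central[where m = "n"] disjI2 conjI)
          (simp_all add: abs_real_def)
    next
      assume "t \<in> {n - \<alpha><..<n - \<alpha> - \<beta>}"
      then have "n - \<alpha> < t" "t < n - \<alpha> - \<beta>" by simp_all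
      with region assms show ?thesis
        by (intro coeffs_positive_if_central[where m = "n"] disjI2 conjI)
          (simp_all add: abs_real_def)
    qed
  qed
  have D1: "coeffs_positive \<alpha> \<beta> t"
    if region: "\<beta> + \<alpha> + 1 < 0" "\<alpha> > \<beta>" "\<beta> > -1"
      and t: "t \<in> (\<Union>n::int. {n - \<beta> - 1<..<n} \<union> {n - \<alpha> - \<beta><..<n - \<alpha> + 1})" for t
  proof -
    from t obtain n :: int where "t \<in> {n - \<beta> - 1<..<n} \<or> t \<in> {n - \<alpha> - \<beta><..<n - \<alpha> + 1}"
      by blast
    then show ?thesis
    proof
      assume "t \<in> {n - \<beta> - 1<..<n}"
      then have "n - \<beta> - 1 < t" "t < n" by simp_all
      with region assms show ?thesis
        by (intro coeffs_positive_if_central[where m = "n - 1"] disjI2 conjI)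
          (simp_all add: abs_real_def)
    next
      assume "t \<in> {n - \<alpha> - \<beta><..<n - \<alpha> + 1}"
      then have "n - \<alpha> - \<beta> < t" "t < n - \<alpha> + 1" by simp_all
      with region assms show ?thesis
        by (intro coeffs_positive_if_central[where m = "n + 1"] disjI2 conjI)
          (simp_all add: abs_real_def)
    qed
  qed
  have D2: "coeffs_positive \<alpha> \<beta> t"
    if region: "\<beta> + \<alpha> + 1 < 0" "\<alpha> < \<beta>" "\<alpha> > -1"
      and t: "t \<in> (\<Union>n::int. {n - \<alpha> - 1<..<n} \<union> {n - \<alpha> - \<beta><..<n - \<beta> + 1})" for t
  proof -
    from t obtain n :: int where "t \<in> {n - \<alpha> - 1<..<n} \<or> t \<in> {n - \<alpha> - \<beta><..<n - \<beta> + 1}"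
      by blast
    then show ?thesis
    proof
      assume "t \<in> {n - \<alpha> - 1<..<n}"
      then have "n - \<alpha> - 1 < t" "t < n" by simp_all
      with region assms show ?thesis
        by (intro coeffs_positive_if_central[where m = "n - 1"] disjI2 conjI)
          (simp_all add: abs_real_def)
    next
      assume "t \<in> {n - \<alpha> - \<beta><..<n - \<beta> + 1}"
      then have "n - \<alpha> - \<beta> < t" "t < n - \<beta> + 1" by simp_all
      with region assms show ?thesis
        by (intro coeffs_positive_if_central[where m = "n + 1"] disjI2 conjI)
          (simp_all add: abs_real_def)
    qed
  qed
  have "\<not> (\<exists>t. coeffs_positive \<alpha> \<beta> t)" if "0 \<le> \<beta>"
    using that coeffs_positive_imp_beta_neg by fastforce
  then show ?thesis
    by (intro conjI impI allI)
      (blast, (elim conjE, (rule A1 A2 B1 B2 C1 C2 D1 D2; assumption))+)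
qed

end
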